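(* No probabilistic algorithm can produce, with positive probability, an infinite binary sequence $\omega$ with the following property: there exists a non-decreasing unbounded computable function $g\colon\mathbb{N}\to\mathbb{N}$ such that $$K(\omega([k,k+n))\mid k,n)\ge g(n)$$ for all natural numbers $k$ and $n$. That is, for every probabilistic algorithm $A$, the probability that $A$ outputs an infinite sequence $\omega$ with this property is $0$.
   Context: A probabilistic algorithm is an algorithm that has access to a source of independent fair random bits and outputs binary digits one after another; with some probability it may output only finitely many bits. For an infinite binary sequence $\omega=\omega_0\omega_1\dots$, $\omega([i,j))$ denotes the substring $\omega_i\omega_{i+1}\dots\omega_{j-1}$. $K(x\mid y)$ denotes conditional Kolmogorov complexity of $x$ given $y$, i.e., the minimal length of a program that transforms $y$ into $x$ (with respect to a fixed optimal conditional decompressor); here the condition is the pair $(k,n)$. *)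

theory Defs
  imports "HOL-Probability.Probability"
begin

datatype recf = Z | S | Proj nat | Comp recf "recf list" | Pr recf recf | Mn recf

inductive eval :: "recf \<Rightarrow> nat list \<Rightarrow> nat \<Rightarrow> bool" where
  eval_Z: "eval Z xs 0"
| eval_S: "eval S (x # xs) (Suc x)"
| eval_Proj: "i < length xs \<Longrightarrow> eval (Proj i) xs (xs ! i)"
| eval_Comp: "list_all2 (\<lambda>g y. eval g xs y) gs ys \<Longrightarrow> eval f ys z \<Longrightarrow> eval (Comp f gs) xs z"
| eval_Pr0: "eval f xs y \<Longrightarrow> eval (Pr f g) (0 # xs) y"
| eval_PrS: "eval (Pr f g) (n # xs) y \<Longrightarrow> eval g (n # y # xs) z \<Longrightarrow> eval (Pr f g) (Suc n # xs) z"
| eval_Mn: "eval f (y # xs) 0 \<Longrightarrow> (\<forall>i<y. \<exists>z. z \<noteq> 0 \<and> eval f (i # xs) z) \<Longrightarrow> eval (Mn f) xs y"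

text \<open>Bijective encoding of binary strings as natural numbers.\<close>
fun enc :: "bool list \<Rightarrow> nat" where
  "enc [] = 0"
| "enc (b # bs) = 2 * enc bs + (if b then 2 else 1)"

definition computable_nat :: "(nat \<Rightarrow> nat) \<Rightarrow> bool" where
  "computable_nat g \<longleftrightarrow> (\<exists>r. \<forall>n. eval r [n] (g n))"

definition computable_str :: "(bool list \<Rightarrow> bool list) \<Rightarrow> bool" where
  "computable_str A \<longleftrightarrow> (\<exists>r. \<forall>u. eval r [enc u] (enc (A u)))"

definition partial_computable_dec :: "(bool list \<Rightarrow> nat \<times> nat \<Rightarrow> bool list option) \<Rightarrow> bool" where
  "partial_computable_dec D \<longleftrightarrow>
     (\<exists>r. \<forall>p k n z. eval r [enc p, k, n] z \<longleftrightarrow> (\<exists>x. D p (k, n) = Some x \<and> z = enc x))"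

definition optimal_dec :: "(bool list \<Rightarrow> nat \<times> nat \<Rightarrow> bool list option) \<Rightarrow> bool" where
  "optimal_dec D \<longleftrightarrow> partial_computable_dec D \<and>
     (\<forall>D'. partial_computable_dec D' \<longrightarrow>
        (\<exists>c. \<forall>p' y x. D' p' y = Some x \<longrightarrow> (\<exists>p. D p y = Some x \<and> length p \<le> length p' + c)))"

text \<open>Conditional Kolmogorov complexity w.r.t. D (infinity if no program exists).\<close>
definition KC :: "(bool list \<Rightarrow> nat \<times> nat \<Rightarrow> bool list option) \<Rightarrow> bool list \<Rightarrow> nat \<times> nat \<Rightarrow> enat" where
  "KC D x y = (INF p\<in>{p. D p y = Some x}. enat (length p))"

text \<open>A probabilistic algorithm is modelled as a total computable, prefix-monotone map
  A from finite strings of random bits to finite output strings: A u is the output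
  printed having read only the random bits u (within |u| steps).\<close>
definition prob_algorithm :: "(bool list \<Rightarrow> bool list) \<Rightarrow> bool" where
  "prob_algorithm A \<longleftrightarrow> computable_str A \<and> (\<forall>u v. prefix u v \<longrightarrow> prefix (A u) (A v))"

definition rprefix :: "(nat \<Rightarrow> bool) \<Rightarrow> nat \<Rightarrow> bool list" where
  "rprefix r m = map r [0..<m]"

definition outputs_inf :: "(bool list \<Rightarrow> bool list) \<Rightarrow> (nat \<Rightarrow> bool) \<Rightarrow> (nat \<Rightarrow> bool) \<Rightarrow> bool" where
  "outputs_inf A r w \<longleftrightarrow>
     (\<forall>i. \<exists>m. i < length (A (rprefix r m))) \<and>
     (\<forall>i m. i < length (A (rprefix r m)) \<longrightarrow> A (rprefix r m) ! i = w i)"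

definition coin :: "(nat \<Rightarrow> bool) measure" where
  "coin = (\<Pi>\<^sub>M i\<in>UNIV. measure_pmf (bernoulli_pmf (1/2)))"

definition segment :: "(nat \<Rightarrow> bool) \<Rightarrow> nat \<Rightarrow> nat \<Rightarrow> bool list" where
  "segment w i j = map w [i..<j]"

end

theory Submission
  imports Defs
begin

text \<open>Let \<open>\<Omega>\<close> be the probability that \<open>A\<close> outputs infinitely many bits, and let \<open>a / b < \<Omega>\<close>. Given \<open>n\<close>,
  put \<open>N = n 2^n\<close> and search for some \<open>m\<close> such that at least the fraction \<open>a / b\<close> of the random strings
  of length \<open>m\<close> yields more than \<open>N + n\<close> output bits. Choosing for \<open>k = 0, 1, \<dots>, N - 1\<close> the most popular
  substring at \<open>[k, k + n)\<close> among the outputs that avoid all previous choices leaves at most the fraction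
  \<open>(1 - 2^-n)^N \<le> 1 / n\<close> of outputs avoiding all of them. The chosen strings are computable from
  \<open>(k, n)\<close>, so their conditional complexity is at most a constant \<open>c\<close>, and a sequence satisfying the
  lower bound \<open>g\<close> avoids them once \<open>g n > c\<close>. Such sequences thus have probability at most
  \<open>P(more than N + n output bits) - a / b + 1 / n\<close>, which tends to \<open>\<Omega> - a / b\<close>, and \<open>a / b\<close> can be
  arbitrarily close to \<open>\<Omega>\<close>. Computability of \<open>g\<close> only serves to make the union over \<open>g\<close> countable.\<close>

section \<open>Recursive functions\<close>

instance recf :: countable
  by countable_datatype

text \<open>The case that is not mere unfolding is \<open>Mn\<close>: of two different results, the
  smaller would be a place where the searched function is both zero and nonzero.\<close>

lemma eval_deterministic: "eval r xs y \<Longrightarrow> eval r xs z \<Longrightarrow> y = z"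
proof (induction arbitrary: z rule: eval.induct)
  case (eval_Comp xs gs ys f z z')
  from eval_Comp.prems obtain ys' where ys': "list_all2 (\<lambda>g y. eval g xs y) gs ys'" "eval f ys' z'"
    by cases
  have "ys = ys'"
    using eval_Comp.IH(1) ys'(1) unfolding list_all2_conv_all_nth by (intro nth_equalityI) auto
  then show ?case using eval_Comp.IH ys' by blast
next
  case (eval_Mn f y xs)
  from eval_Mn.prems have z: "eval f (z # xs) 0" "\<forall>i<z. \<exists>v. v \<noteq> 0 \<and> eval f (i # xs) v"
    by (cases; blast)+
  show ?case
  proof (cases y z rule: linorder_cases)
    case less
    then show ?thesis using z eval_Mn.IH by blast
  next
    case greater
    then show ?thesis using z eval_Mn.IH by metis
  qed
next
  case (eval_PrS f g n xs y z z')
  from eval_PrS.prems obtain y' where "eval (Pr f g) (n # xs) y'" "eval g (n # y' # xs) z'"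
    by cases
  then show ?case using eval_PrS.IH by metis
next
  case (eval_Pr0 f xs y g)
  from eval_Pr0.prems show ?case by cases (use eval_Pr0.IH in blast)
qed (erule eval.cases; simp; fail)+

text \<open>There are countably many terms in \<open>recf\<close>, and by determinism the choice of
  one code per function is injective.\<close>

lemma countable_computable_nat: "countable {g. computable_nat g}"
proof -
  define code where "code g = (SOME r. \<forall>n. eval r [n] (g n))" for g
  have code: "eval (code g) [n] (g n)" if "computable_nat g" for g n
    using that unfolding computable_nat_def code_def by (rule someI2_ex) blast
  have "inj_on code {g. computable_nat g}"
    by (intro inj_onI ext) (metis code eval_deterministic mem_Collect_eq)
  then show ?thesis by (rule countableI')
qed

text \<open>A semantic notion of total recursive function: closure rules for it replace explicit
  \<open>recf\<close> terms. Values on lists of other lengths are left free.\<close>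

definition rec_fun :: "nat \<Rightarrow> (nat list \<Rightarrow> nat) \<Rightarrow> bool" where
  "rec_fun a f \<longleftrightarrow> (\<exists>r. \<forall>xs. length xs = a \<longrightarrow> eval r xs (f xs))"

lemma rec_fun_cong:
  "rec_fun a f \<Longrightarrow> (\<And>xs. length xs = a \<Longrightarrow> f xs = g xs) \<Longrightarrow> rec_fun a g"
  unfolding rec_fun_def by metis

lemma rec_fun_nth: "i < a \<Longrightarrow> rec_fun a (\<lambda>xs. xs ! i)"
  unfolding rec_fun_def using eval_Proj by blast

text \<open>Rules for binders prepend the bound variable to the argument list: under a binder it is \<open>xs ! 0\<close>
  and the outer arguments are \<open>tl xs\<close>.\<close>

lemma rec_fun_tl_nth: "i < a \<Longrightarrow> rec_fun (Suc a) (\<lambda>xs. tl xs ! i)"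
  by (rule rec_fun_cong[OF rec_fun_nth[of "Suc i"]]) (auto simp: nth_tl)

lemma rec_fun_tl_tl_nth: "i < a \<Longrightarrow> rec_fun (Suc (Suc a)) (\<lambda>xs. tl (tl xs) ! i)"
  by (rule rec_fun_cong[OF rec_fun_nth[of "Suc (Suc i)"]]) (auto simp: nth_tl)

lemma rec_fun_tl_tl_tl_nth: "i < a \<Longrightarrow> rec_fun (Suc (Suc (Suc a))) (\<lambda>xs. tl (tl (tl xs)) ! i)"
  by (rule rec_fun_cong[OF rec_fun_nth[of "Suc (Suc (Suc i))"]]) (auto simp: nth_tl)

lemma rec_fun_comp:
  assumes "rec_fun (length gs) f" and "\<And>g. g \<in> set gs \<Longrightarrow> rec_fun a g"
  shows "rec_fun a (\<lambda>xs. f (map (\<lambda>g. g xs) gs))"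
proof -
  obtain rf where rf: "\<And>xs. length xs = length gs \<Longrightarrow> eval rf xs (f xs)"
    using assms(1) unfolding rec_fun_def by blast
  obtain rg where rg: "\<And>g xs. g \<in> set gs \<Longrightarrow> length xs = a \<Longrightarrow> eval (rg g) xs (g xs)"
    using assms(2) unfolding rec_fun_def by metis
  have "eval (Comp rf (map rg gs)) xs (f (map (\<lambda>g. g xs) gs))" if "length xs = a" for xs
    by (rule eval_Comp[OF _ rf]) (auto simp: list_all2_conv_all_nth intro: rg that)
  then show ?thesis unfolding rec_fun_def by blast
qed

lemma rec_fun_comp1:
  assumes "rec_fun 1 (\<lambda>xs. h (xs ! 0))" and "rec_fun a f"
  shows "rec_fun a (\<lambda>xs. h (f xs))"
  using rec_fun_comp[of "[f]" "\<lambda>xs. h (xs ! 0)" a] assms by simp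

lemma rec_fun_Suc: "rec_fun a f \<Longrightarrow> rec_fun a (\<lambda>xs. Suc (f xs))"
proof (rule rec_fun_comp1[of Suc])
  have "eval S xs (Suc (xs ! 0))" if "length xs = 1" for xs
    using that eval_S[of "hd xs" "tl xs"] by (cases xs) auto
  then show "rec_fun 1 (\<lambda>xs. Suc (xs ! 0))" unfolding rec_fun_def by blast
qed

lemma rec_fun_const: "rec_fun a (\<lambda>_. c)"
proof (induction c)
  case 0
  show ?case unfolding rec_fun_def using eval_Z by blast
next
  case (Suc c)
  then show ?case by (rule rec_fun_Suc)
qed

lemma rec_fun_rec_nat:
  assumes b: "rec_fun a b" and f: "rec_fun a f"
    and s: "rec_fun (Suc (Suc a)) (\<lambda>xs. s (xs ! 0) (xs ! 1) (tl (tl xs)))"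
  shows "rec_fun a (\<lambda>xs. rec_nat (f xs) (\<lambda>i y. s i y xs) (b xs))"
proof -
  obtain rf where rf: "\<And>xs. length xs = a \<Longrightarrow> eval rf xs (f xs)"
    using f unfolding rec_fun_def by blast
  obtain rs where rs: "\<And>xs. length xs = Suc (Suc a) \<Longrightarrow> eval rs xs (s (xs ! 0) (xs ! 1) (tl (tl xs)))"
    using s unfolding rec_fun_def by blast
  let ?h = "\<lambda>xs. rec_nat (f (tl xs)) (\<lambda>i y. s i y (tl xs)) (xs ! 0)"
  have "eval (Pr rf rs) (n # ys) (rec_nat (f ys) (\<lambda>i y. s i y ys) n)" if "length ys = a" for n ys
  proof (induction n)
    case 0
    show ?case using rf[OF that] by (auto intro: eval_Pr0)
  next
    case (Suc n)
    show ?case using eval_PrS[OF Suc rs] that by simp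
  qed
  then have "eval (Pr rf rs) xs (?h xs)" if "length xs = Suc a" for xs
    using that by (cases xs) auto
  then have h: "rec_fun (Suc a) ?h" unfolding rec_fun_def by blast
  \<comment> \<open>\<open>Pr\<close> recurses on its first argument, so the number of rounds
    \<open>b\<close> is put in front of a copy of the whole argument list.\<close>
  let ?gs = "b # map (\<lambda>i xs. xs ! i) [0..<a]"
  have nth_id: "map ((!) xs) [0..<a] = xs" if "length xs = a" for xs :: "nat list"
    using that map_nth by blast
  have "rec_fun a (\<lambda>xs. ?h (map (\<lambda>g. g xs) ?gs))"
    by (rule rec_fun_comp) (use h b in \<open>auto intro: rec_fun_nth\<close>)
  then show ?thesis
    by (rule rec_fun_cong) (simp add: o_def nth_id)
qed

lemma rec_fun_add: "rec_fun a f \<Longrightarrow> rec_fun a g \<Longrightarrow> rec_fun a (\<lambda>xs. f xs + g xs)"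
proof -
  assume *: "rec_fun a f" "rec_fun a g"
  have "rec_nat x (\<lambda>_. Suc) y = x + y" for x y :: nat
    by (induction y) auto
  then show ?thesis
    using rec_fun_rec_nat[OF *(2,1), of "\<lambda>_ y _. Suc y"] by (simp add: rec_fun_Suc rec_fun_nth)
qed

lemma rec_fun_sum:
  assumes b: "rec_fun a b" and f: "rec_fun (Suc a) (\<lambda>xs. f (xs ! 0) (tl xs))"
  shows "rec_fun a (\<lambda>xs. \<Sum>i<b xs. f i xs)"
proof -
  let ?gs = "(\<lambda>xs. xs ! 0) # map (\<lambda>i xs. xs ! (i + 2)) [0..<a]"
  have drop: "map (\<lambda>i. xs ! Suc (Suc i)) [0..<a] = tl (tl xs)" if "length xs = Suc (Suc a)" for xs :: "nat list"
    using that by (intro nth_equalityI) (auto simp: nth_tl)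
  have "rec_fun (Suc (Suc a)) (\<lambda>xs. (\<lambda>xs. f (xs ! 0) (tl xs)) (map (\<lambda>g. g xs) ?gs))"
    by (rule rec_fun_comp) (use f in \<open>auto intro: rec_fun_nth\<close>)
  then have "rec_fun (Suc (Suc a)) (\<lambda>xs. f (xs ! 0) (tl (tl xs)))"
    by (rule rec_fun_cong) (simp add: o_def drop)
  then have "rec_fun (Suc (Suc a)) (\<lambda>xs. xs ! 1 + f (xs ! 0) (tl (tl xs)))"
    by (intro rec_fun_add rec_fun_nth) auto
  from rec_fun_rec_nat[OF b rec_fun_const[of _ 0] this]
  have "rec_fun a (\<lambda>xs. rec_nat 0 (\<lambda>i y. y + f i xs) (b xs))" .
  moreover have "rec_nat 0 (\<lambda>i y. y + h i) n = (\<Sum>i<n. h i)" for h :: "nat \<Rightarrow> nat" and n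
    by (induction n) auto
  ultimately show ?thesis by simp
qed

lemma rec_fun_tl:
  assumes "rec_fun a f"
  shows "rec_fun (Suc a) (\<lambda>xs. f (tl xs))"
proof -
  let ?gs = "map (\<lambda>i xs. xs ! Suc i) [0..<a]"
  have drop: "map (\<lambda>i. xs ! Suc i) [0..<a] = tl xs" if "length xs = Suc a" for xs :: "nat list"
    using that by (intro nth_equalityI) (auto simp: nth_tl)
  have "rec_fun (Suc a) (\<lambda>xs. f (map (\<lambda>g. g xs) ?gs))"
    by (rule rec_fun_comp) (use assms in \<open>auto intro: rec_fun_nth\<close>)
  then show ?thesis
    by (rule rec_fun_cong) (simp add: o_def drop)
qed

lemma rec_fun_mult:
  assumes "rec_fun a f" "rec_fun a g"
  shows "rec_fun a (\<lambda>xs. f xs * g xs)"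
  using rec_fun_sum[OF assms(2), of "\<lambda>_ xs. f xs", OF rec_fun_tl[OF assms(1)]]
  by (simp add: mult.commute)

lemma rec_fun_power2: "rec_fun a f \<Longrightarrow> rec_fun a (\<lambda>xs. 2 ^ f xs)"
proof -
  assume *: "rec_fun a f"
  have "rec_nat 1 (\<lambda>_ y. y + y) n = (2 :: nat) ^ n" for n
    by (induction n) auto
  then show ?thesis
    using rec_fun_rec_nat[OF * rec_fun_const[of _ 1], of "\<lambda>_ y _. y + y"]
    by (simp add: rec_fun_add rec_fun_nth)
qed

text \<open>Truncated subtraction is the iterated predecessor, and the predecessor is itself a
  recursion that returns its last index.\<close>

lemma rec_fun_diff:
  assumes "rec_fun a f" "rec_fun a g"
  shows "rec_fun a (\<lambda>xs. f xs - g xs)"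
proof -
  have pred: "rec_nat 0 (\<lambda>i _. i) n = n - 1" for n :: nat
    by (cases n) auto
  have "rec_fun 1 (\<lambda>xs. xs ! 0 - 1)"
    using rec_fun_rec_nat[OF rec_fun_nth[of 0 1] rec_fun_const[of _ 0], of "\<lambda>i _ _. i"]
    by (simp add: pred rec_fun_nth)
  then have "rec_fun (Suc (Suc a)) (\<lambda>xs. xs ! 1 - 1)"
    by (rule rec_fun_comp1) (simp add: rec_fun_nth)
  moreover have "rec_nat x (\<lambda>_ y. y - 1) y = x - y" for x y :: nat
    by (induction y) auto
  ultimately show ?thesis
    using rec_fun_rec_nat[OF assms(2,1), of "\<lambda>_ y _. y - 1"] by simp
qed

section \<open>Decidable relations and unbounded search\<close>

lemma rec_fun_less:
  assumes "rec_fun a f" "rec_fun a g"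
  shows "rec_fun a (\<lambda>xs. of_bool (f xs < g xs))"
proof -
  \<comment> \<open>With truncated subtraction, \<open>1 - (1 - d)\<close> is 1 for positive
    \<open>d\<close> and 0 for \<open>d = 0\<close>.\<close>
  have "rec_fun a (\<lambda>xs. 1 - (1 - (g xs - f xs)))"
    by (intro rec_fun_diff rec_fun_const assms)
  then show ?thesis by (rule rec_fun_cong) auto
qed

lemma rec_fun_not:
  assumes "rec_fun a (\<lambda>xs. of_bool (P xs))"
  shows "rec_fun a (\<lambda>xs. of_bool (\<not> P xs))"
  by (rule rec_fun_cong[OF rec_fun_diff[OF rec_fun_const[of _ 1] assms]]) auto

lemma rec_fun_conj:
  assumes "rec_fun a (\<lambda>xs. of_bool (P xs))" "rec_fun a (\<lambda>xs. of_bool (Q xs))"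
  shows "rec_fun a (\<lambda>xs. of_bool (P xs \<and> Q xs))"
  by (rule rec_fun_cong[OF rec_fun_mult[OF assms]]) auto

lemma rec_fun_le:
  assumes "rec_fun a f" "rec_fun a g"
  shows "rec_fun a (\<lambda>xs. of_bool (f xs \<le> g xs))"
  using rec_fun_not[OF rec_fun_less[OF assms(2,1)]] by (simp add: not_less)

lemma rec_fun_eq:
  assumes "rec_fun a f" "rec_fun a g"
  shows "rec_fun a (\<lambda>xs. of_bool (f xs = g xs))"
  using rec_fun_conj[OF rec_fun_le[OF assms] rec_fun_le[OF assms(2,1)]] by (simp add: order_eq_iff)

lemma rec_fun_all_less:
  assumes b: "rec_fun a b" and P: "rec_fun (Suc a) (\<lambda>xs. of_bool (P (xs ! 0) (tl xs)))"
  shows "rec_fun a (\<lambda>xs. of_bool (\<forall>i<b xs. P i xs))"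
proof -
  have "rec_fun a (\<lambda>xs. of_bool ((\<Sum>i<b xs. of_bool (\<not> P i xs)) = (0 :: nat)))"
    by (intro rec_fun_eq rec_fun_const rec_fun_sum b rec_fun_not P)
  moreover have "(\<Sum>i<b xs. of_bool (\<not> P i xs)) = (0 :: nat) \<longleftrightarrow> (\<forall>i<b xs. P i xs)" for xs
    by auto
  ultimately show ?thesis by simp
qed

text \<open>\<open>Mn\<close> looks for a zero, so it is applied to the negated predicate. By
  \<open>ex\<close> the search halts on all arguments, and below the least witness all values are 1,
  as \<open>eval_Mn\<close> demands.\<close>

lemma rec_fun_Least:
  assumes ex: "\<And>xs. \<exists>y. P y xs" and P: "rec_fun (Suc a) (\<lambda>xs. of_bool (P (xs ! 0) (tl xs)))"
  shows "rec_fun a (\<lambda>xs. LEAST y. P y xs)"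
proof -
  obtain r where r: "\<And>xs. length xs = Suc a \<Longrightarrow> eval r xs (of_bool (\<not> P (xs ! 0) (tl xs)))"
    using rec_fun_not[OF P] unfolding rec_fun_def by blast
  have "eval (Mn r) xs (LEAST y. P y xs)" if "length xs = a" for xs
  proof (rule eval_Mn)
    have "P (LEAST y. P y xs) xs" using ex by (rule LeastI_ex)
    then show "eval r ((LEAST y. P y xs) # xs) 0"
      using r[of "(LEAST y. P y xs) # xs"] that by simp
    show "\<forall>i<LEAST y. P y xs. \<exists>z. z \<noteq> 0 \<and> eval r (i # xs) z"
    proof safe
      fix i assume "i < (LEAST y. P y xs)"
      then have "\<not> P i xs" by (rule not_less_Least)
      then show "\<exists>z. z \<noteq> 0 \<and> eval r (i # xs) z"
        using r[of "i # xs"] that by (intro exI[of _ 1]) simp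
    qed
  qed
  then show ?thesis unfolding rec_fun_def by blast
qed


section \<open>Computing with encoded strings\<close>

definition dec :: "nat \<Rightarrow> bool list" where
  "dec = inv enc"

text \<open>Only the empty string has code 0; otherwise the parity of the code reveals the first bit
  (even for \<open>True\<close>), and the rest determines the tail.\<close>

lemma inj_enc: "inj enc"
proof (rule injI)
  fix u v show "enc u = enc v \<Longrightarrow> u = v"
  proof (induction u arbitrary: v)
    case Nil
    then show ?case by (cases v) (auto split: if_splits)
  next
    case (Cons b u)
    then obtain b' v' where v: "v = b' # v'" by (cases v) (auto split: if_splits)
    have "b = b' \<and> enc u = enc v'"
      using Cons.prems unfolding v by (auto split: if_splits) presburger+
    then show ?case using Cons.IH v by simp
  qed
qed

lemma surj_enc: "surj enc"
proof -
  have "\<exists>u. enc u = c" for c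
  proof (induction c rule: less_induct)
    case (less c)
    show ?case
    proof (cases "c = 0")
      case True
      then show ?thesis by (intro exI[of _ "[]"]) simp
    next
      case False
      then have "(c - 1) div 2 < c" by presburger
      then obtain u where "enc u = (c - 1) div 2" using less by blast
      then show ?thesis using False by (intro exI[of _ "even c # u"]) auto
    qed
  qed
  then show ?thesis by (metis surjI)
qed

lemma dec_enc [simp]: "dec (enc u) = u"
  unfolding dec_def using inj_enc by simp

lemma enc_dec [simp]: "enc (dec c) = c"
  unfolding dec_def using surj_enc by (simp add: surj_f_inv_f)

lemma enc_eq_iff: "enc u = enc v \<longleftrightarrow> u = v"
  using inj_enc by (simp add: inj_eq)

lemma enc_eq_0_iff: "enc u = 0 \<longleftrightarrow> u = []"
  by (cases u) auto

text \<open>A nonempty \<open>u\<close> has code \<open>2 * enc (tl u)\<close> plus 1 or 2, so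
  minimization takes the place of a division by two.\<close>

lemma enc_tl: "enc (tl u) = (LEAST v. enc u \<le> 2 * v + 2)"
  by (rule Least_equality[symmetric]; cases u) (auto split: if_splits)

text \<open>\<open>enc\<close> is bijective base-two notation with digits 1 and 2, least significant
  first; behind \<open>u\<close>, the digits of \<open>v\<close> are shifted by
  \<open>length u\<close> places.\<close>

lemma enc_append: "enc (u @ v) = enc u + 2 ^ length u * enc v"
  by (induction u) (auto simp: algebra_simps)

lemma enc_take: "enc (take n u) = enc u - 2 ^ n * enc (drop n u)"
proof (cases "n \<le> length u")
  case True
  then show ?thesis using enc_append[of "take n u" "drop n u"] by simp
qed simp

text \<open>The successor on the left makes the induction go through, where a digit 2 would spoil
  the bound on \<open>enc u\<close> alone. The bound limits the codes to be inspected when strings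
  of a given length are counted.\<close>

lemma Suc_enc_less: "Suc (enc u) < 2 ^ Suc (length u)"
  by (induction u) auto

lemma rec_fun_drop:
  assumes "rec_fun a (\<lambda>xs. enc (F xs))" "rec_fun a k"
  shows "rec_fun a (\<lambda>xs. enc (drop (k xs) (F xs)))"
proof -
  have *: "rec_nat (enc u) (\<lambda>_ y. LEAST v. y \<le> 2 * v + 2) n = enc (drop n u)" for u n
    by (induction n) (simp_all add: drop_Suc drop_tl enc_tl)
  have "rec_fun (Suc (Suc a)) (\<lambda>xs. LEAST v. xs ! 1 \<le> 2 * v + 2)"
  proof (rule rec_fun_Least)
    show "\<exists>v. xs ! 1 \<le> 2 * v + 2" for xs :: "nat list"
      by (rule exI[of _ "xs ! 1"]) simp
    show "rec_fun (Suc (Suc (Suc a))) (\<lambda>xs. of_bool (tl xs ! 1 \<le> 2 * xs ! 0 + 2))"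
      by (intro rec_fun_le rec_fun_add rec_fun_mult rec_fun_const rec_fun_nth rec_fun_tl_nth) simp_all
  qed
  from rec_fun_rec_nat[OF assms(2,1) this] show ?thesis by (simp only: *)
qed

lemma rec_fun_take:
  assumes "rec_fun a (\<lambda>xs. enc (F xs))" "rec_fun a k"
  shows "rec_fun a (\<lambda>xs. enc (take (k xs) (F xs)))"
  unfolding enc_take by (intro rec_fun_diff rec_fun_mult rec_fun_power2 rec_fun_drop assms)

text \<open>Brings a number that is read as a string into the form \<open>enc (F xs)\<close> on
  which the rules for strings operate.\<close>

lemma rec_fun_enc_dec: "rec_fun a f \<Longrightarrow> rec_fun a (\<lambda>xs. enc (dec (f xs)))"
  by simp

lemma rec_fun_enc_eq:
  assumes "rec_fun a (\<lambda>xs. enc (F xs))" "rec_fun a (\<lambda>xs. enc (G xs))"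
  shows "rec_fun a (\<lambda>xs. of_bool (F xs = G xs))"
  using rec_fun_eq[OF assms] by (simp add: enc_eq_iff)

lemma rec_fun_length:
  assumes "rec_fun a (\<lambda>xs. enc (F xs))"
  shows "rec_fun a (\<lambda>xs. length (F xs))"
proof -
  have "rec_fun a (\<lambda>xs. LEAST l. enc (drop l (F xs)) = 0)"
  proof (rule rec_fun_Least)
    show "\<exists>l. enc (drop l (F xs)) = 0" for xs
      by (rule exI[of _ "length (F xs)"]) simp
    show "rec_fun (Suc a) (\<lambda>xs. of_bool (enc (drop (xs ! 0) (F (tl xs))) = 0))"
      by (intro rec_fun_eq rec_fun_const rec_fun_drop rec_fun_nth rec_fun_tl[where f = "\<lambda>xs. enc (F xs)"] assms) simp
  qed
  moreover have "(LEAST l. enc (drop l u) = 0) = length u" for u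
    by (rule Least_equality) (auto simp: enc_eq_0_iff)
  ultimately show ?thesis by simp
qed

text \<open>Strings of length \<open>m xs\<close> have codes below \<open>2 ^ Suc (m xs)\<close>, so
  the cardinality is a bounded sum of indicators over codes.\<close>

lemma rec_fun_card_strings:
  assumes m: "rec_fun a m"
    and P: "rec_fun (Suc a) (\<lambda>xs. of_bool (P (dec (xs ! 0)) (tl xs)))"
  shows "rec_fun a (\<lambda>xs. card {u. length u = m xs \<and> P u xs})"
proof -
  let ?Q = "\<lambda>i xs. length (dec i) = m xs \<and> P (dec i) xs"
  have "rec_fun (Suc a) (\<lambda>xs. of_bool (?Q (xs ! 0) (tl xs)))"
    by (intro rec_fun_conj rec_fun_eq rec_fun_length rec_fun_enc_dec rec_fun_nth rec_fun_tl P m) simp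
  then have "rec_fun a (\<lambda>xs. \<Sum>i<2 ^ Suc (m xs). of_bool (?Q i xs))"
    by (intro rec_fun_sum rec_fun_power2 rec_fun_Suc m)
  moreover have "(\<Sum>i<2 ^ Suc (m xs). of_bool (?Q i xs)) = card {u. length u = m xs \<and> P u xs}" for xs
  proof -
    have "bij_betw dec ({..<2 ^ Suc (m xs)} \<inter> {i. ?Q i xs}) {u. length u = m xs \<and> P u xs}"
    proof (rule bij_betwI[of _ _ _ enc])
      have "enc u < 2 ^ Suc (m xs)" if "length u = m xs" for u
        using Suc_lessD[OF Suc_enc_less[of u]] that by simp
      then show "enc \<in> {u. length u = m xs \<and> P u xs} \<rightarrow> {..<2 ^ Suc (m xs)} \<inter> {i. ?Q i xs}"
        by auto
    qed auto
    then show ?thesis by (simp add: bij_betw_same_card sum_of_bool_eq)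
  qed
  ultimately show ?thesis by simp
qed

lemmas rec_fun_intros =
  rec_fun_less rec_fun_not rec_fun_conj rec_fun_le rec_fun_enc_eq rec_fun_all_less
  rec_fun_card_strings rec_fun_length rec_fun_take rec_fun_drop rec_fun_enc_dec
  rec_fun_add rec_fun_mult rec_fun_power2 rec_fun_const rec_fun_nth rec_fun_tl_nth
  rec_fun_tl_tl_nth rec_fun_tl_tl_tl_nth

section \<open>The greedy choice\<close>

lemma finite_strings: "finite {u :: bool list. length u = n}"
  using finite_lists_length_eq[of "UNIV :: bool set" n] by simp

lemma card_strings: "card {u :: bool list. length u = n} = 2 ^ n"
  using card_lists_length_eq[of "UNIV :: bool set" n] by simp

text \<open>Averaging over the \<open>2 ^ n\<close> strings of length \<open>n\<close>: if each were
  attained too rarely, summation would give \<open>2 ^ n * card V < 2 ^ n * card V\<close>.\<close>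

lemma exists_popular_string:
  fixes f :: "'a \<Rightarrow> bool list"
  assumes "finite V" and len: "\<And>u. u \<in> V \<Longrightarrow> length (f u) = n"
  obtains x where "length x = n" "card V \<le> 2 ^ n * card {u \<in> V. f u = x}"
proof -
  have "\<exists>x\<in>{x. length x = n}. card V \<le> 2 ^ n * card {u \<in> V. f u = x}"
  proof (rule ccontr)
    assume "\<not> ?thesis"
    then have "(\<Sum>x | length x = n. 2 ^ n * card {u \<in> V. f u = x}) < (\<Sum>x :: bool list | length x = n. card V)"
      by (intro sum_strict_mono finite_strings) (auto simp: not_le intro: exI[of _ "replicate n True"])
    moreover have "(\<Sum>x | length x = n. card {u \<in> V. f u = x}) = card V"
      using sum.group[OF assms(1) finite_strings[of n], of f "\<lambda>_. 1 :: nat"] len by auto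
    ultimately show False by (simp add: card_strings flip: sum_distrib_left)
  qed
  then show ?thesis using that by blast
qed

text \<open>The windows of \<open>f u\<close> start at consecutive positions and overlap, whereas the
  forbidden strings are stored in \<open>T\<close> one after another.\<close>

lemma exists_avoided_strings:
  fixes f :: "'a \<Rightarrow> bool list"
  assumes "finite U" and "\<And>u. u \<in> U \<Longrightarrow> N + n \<le> length (f u)"
  shows "\<exists>T. length T = N * n \<and>
    real (card {u \<in> U. \<forall>k<N. take n (drop k (f u)) \<noteq> take n (drop (k * n) T)})
      \<le> (1 - 1 / 2 ^ n) ^ N * card U"
  using assms(2)
proof (induction N)
  case 0
  then show ?case by simp
next
  case (Suc N)
  define V where "V T M = {u \<in> U. \<forall>k<M. take n (drop k (f u)) \<noteq> take n (drop (k * n) T)}" for T M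
  obtain T where T: "length T = N * n" "real (card (V T N)) \<le> (1 - 1 / 2 ^ n) ^ N * card U"
    using Suc.IH[OF Suc_leD] Suc.prems unfolding V_def by auto
  have fin: "finite (V T N)" using assms(1) unfolding V_def by simp
  obtain x where x: "length x = n" "card (V T N) \<le> 2 ^ n * card {u \<in> V T N. take n (drop N (f u)) = x}"
  proof (rule exists_popular_string[OF fin])
    show "length (take n (drop N (f u))) = n" if "u \<in> V T N" for u
      using that Suc.prems[of u] unfolding V_def by simp
  qed
  let ?W = "{u \<in> V T N. take n (drop N (f u)) = x}"
  have old: "take n (drop (k * n) (T @ x)) = take n (drop (k * n) T)" if "k < N" for k
  proof -
    \<comment> \<open>Block \<open>k\<close> ends at \<open>Suc k * n\<close>, inside
      \<open>T\<close>, so appending \<open>x\<close> does not alter it.\<close>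
    have "Suc k * n \<le> N * n" using that by (intro mult_right_mono) auto
    then show ?thesis using T(1) by simp
  qed
  have new: "take n (drop (N * n) (T @ x)) = x" using T(1) x(1) by simp
  have "V (T @ x) (Suc N) = V T N - ?W"
    unfolding V_def All_less_Suc by (auto simp: old new simp del: drop_append take_append)
  moreover have "card ?W \<le> card (V T N)" using fin by (intro card_mono) auto
  ultimately have "real (card (V (T @ x) (Suc N))) = real (card (V T N)) - real (card ?W)"
    using fin by (simp add: card_Diff_subset of_nat_diff)
  \<comment> \<open>By the popularity of \<open>x\<close>, the set \<open>?W\<close> contains at
    least the fraction \<open>1 / 2 ^ n\<close> of \<open>V T N\<close>.\<close>
  also have "\<dots> \<le> (1 - 1 / 2 ^ n) * card (V T N)"
  proof -
    have "real (card (V T N)) \<le> 2 ^ n * real (card ?W)"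
      using of_nat_mono[OF x(2), where ?'a = real] by simp
    then have "real (card (V T N)) / 2 ^ n \<le> real (card ?W)"
      by (simp add: divide_le_eq mult.commute)
    then show ?thesis by (simp add: left_diff_distrib)
  qed
  also have "\<dots> \<le> (1 - 1 / 2 ^ n) * ((1 - 1 / 2 ^ n) ^ N * card U)"
    using T(2) by (intro mult_left_mono) auto
  finally have "real (card (V (T @ x) (Suc N))) \<le> (1 - 1 / 2 ^ n) ^ Suc N * card U"
    by (simp only: power_Suc mult.assoc)
  moreover have "length (T @ x) = Suc N * n" using T(1) x(1) by simp
  ultimately show ?case unfolding V_def by blast
qed

text \<open>From \<open>1 - t \<le> exp (- t)\<close> with \<open>t = 1 / 2 ^ n\<close> the power is
  at most \<open>exp (- n)\<close>; the exponent \<open>n * 2 ^ n\<close> is chosen to cancel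
  \<open>2 ^ n\<close>. The product form also covers \<open>n = 0\<close>.\<close>

lemma power_blocks_le: "real n * (1 - 1 / 2 ^ n) ^ (n * 2 ^ n) \<le> 1"
proof -
  have "(1 - 1 / 2 ^ n) ^ (n * 2 ^ n) \<le> exp (- 1 / 2 ^ n :: real) ^ (n * 2 ^ n)"
    using exp_ge_add_one_self[of "- 1 / 2 ^ n"] by (intro power_mono) auto
  also have "\<dots> = exp (- real n)"
    by (simp flip: exp_of_nat_mult)
  finally have "real n * (1 - 1 / 2 ^ n) ^ (n * 2 ^ n) \<le> real n * exp (- real n)"
    by (intro mult_left_mono) auto
  also have "\<dots> \<le> 1"
  proof -
    have "real n \<le> exp (real n)" using exp_ge_add_one_self[of "real n"] by linarith
    then show ?thesis by (simp add: exp_minus field_simps)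
  qed
  finally show ?thesis .
qed

section \<open>Computable choice of the forbidden strings\<close>

text \<open>The comparison of \<open>a / b\<close> with a relative frequency is cleared of
  denominators, so that the search tests a decidable relation between natural numbers.\<close>

definition stage :: "(bool list \<Rightarrow> bool list) \<Rightarrow> nat \<Rightarrow> nat \<Rightarrow> nat \<Rightarrow> nat" where
  "stage A a b n =
    (LEAST m. a * 2 ^ m \<le> b * card {u. length u = m \<and> n * 2 ^ n + n < length (A u)})"

definition evading :: "(bool list \<Rightarrow> bool list) \<Rightarrow> nat \<Rightarrow> nat \<Rightarrow> bool list \<Rightarrow> bool list set" where
  "evading A n m T = {u. length u = m \<and> n * 2 ^ n + n < length (A u) \<and>
    (\<forall>k<n * 2 ^ n. take n (drop k (A u)) \<noteq> take n (drop (k * n) T))}"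

text \<open>The greedy construction is not itself computed: it only shows that a suitable string
  exists, and the one with the least code is taken.\<close>

definition cover :: "(bool list \<Rightarrow> bool list) \<Rightarrow> nat \<Rightarrow> nat \<Rightarrow> nat \<Rightarrow> bool list" where
  "cover A a b n =
    dec (LEAST s. n * card (evading A n (stage A a b n) (dec s)) \<le> 2 ^ stage A a b n)"

definition forbidden :: "(bool list \<Rightarrow> bool list) \<Rightarrow> nat \<Rightarrow> nat \<Rightarrow> nat \<Rightarrow> nat \<Rightarrow> bool list" where
  "forbidden A a b k n = take n (drop (k * n) (cover A a b n))"

text \<open>The greedy bound multiplied by \<open>n\<close>: by \<open>power_blocks_le\<close> the
  factor in front of \<open>card ?U\<close> is at most 1, whatever \<open>m\<close> is.\<close>

lemma exists_cover: "\<exists>s. n * card (evading A n m (dec s)) \<le> 2 ^ m"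
proof -
  let ?U = "{u. length u = m \<and> n * 2 ^ n + n < length (A u)}"
  have "finite ?U" by (rule finite_subset[OF _ finite_strings[of m]]) auto
  then obtain T where "real (card {u \<in> ?U. \<forall>k<n * 2 ^ n. take n (drop k (A u)) \<noteq> take n (drop (k * n) T)})
      \<le> (1 - 1 / 2 ^ n) ^ (n * 2 ^ n) * card ?U"
    using exists_avoided_strings[of ?U "n * 2 ^ n" n A] by auto
  moreover have "{u \<in> ?U. \<forall>k<n * 2 ^ n. take n (drop k (A u)) \<noteq> take n (drop (k * n) T)} = evading A n m T"
    unfolding evading_def by auto
  ultimately have "real (card (evading A n m T)) \<le> (1 - 1 / 2 ^ n) ^ (n * 2 ^ n) * card ?U" by simp
  then have "real n * card (evading A n m T) \<le> real n * ((1 - 1 / 2 ^ n) ^ (n * 2 ^ n) * card ?U)"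
    by (rule mult_left_mono) simp
  also have "\<dots> = (real n * (1 - 1 / 2 ^ n) ^ (n * 2 ^ n)) * card ?U" by (simp only: mult.assoc)
  also have "\<dots> \<le> 1 * real (card ?U)" by (intro mult_right_mono power_blocks_le) simp
  also have "card ?U \<le> 2 ^ m"
    unfolding card_strings[of m, symmetric] by (intro card_mono finite_strings) auto
  finally have "real (n * card (evading A n m T)) \<le> real (2 ^ m)" by simp
  then have "n * card (evading A n m T) \<le> 2 ^ m" by (simp only: of_nat_le_iff)
  then show ?thesis by (intro exI[of _ "enc T"]) simp
qed

lemma card_evading_cover: "n * card (evading A n (stage A a b n) (cover A a b n)) \<le> 2 ^ stage A a b n"
  unfolding cover_def by (rule LeastI_ex[OF exists_cover])

lemma rec_fun_computable_str:
  assumes "computable_str A" and "rec_fun a (\<lambda>xs. enc (F xs))"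
  shows "rec_fun a (\<lambda>xs. enc (A (F xs)))"
proof -
  obtain r where r: "\<And>u. eval r [enc u] (enc (A u))"
    using assms(1) unfolding computable_str_def by blast
  have "eval r xs (enc (A (dec (xs ! 0))))" if "length xs = 1" for xs
    using that r[of "dec (xs ! 0)"] by (cases xs) auto
  then have "rec_fun 1 (\<lambda>xs. enc (A (dec (xs ! 0))))" unfolding rec_fun_def by blast
  from rec_fun_comp1[OF this assms(2)] show ?thesis by simp
qed

lemma rec_fun_stage:
  assumes "computable_str A"
    and "\<And>n. \<exists>m. a * 2 ^ m \<le> b * card {u. length u = m \<and> n * 2 ^ n + n < length (A u)}"
    and "rec_fun j f"
  shows "rec_fun j (\<lambda>xs. stage A a b (f xs))"
proof (rule rec_fun_comp1[OF _ assms(3)])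
  show "rec_fun 1 (\<lambda>xs. stage A a b (xs ! 0))"
    unfolding stage_def
    by (intro rec_fun_Least assms(2) rec_fun_intros rec_fun_computable_str[OF assms(1)]) simp_all
qed

text \<open>Both unbounded searches halt: the one for \<open>stage\<close> by assumption, the one
  for \<open>cover\<close> by \<open>exists_cover\<close>. There are three arguments because a
  decompressor also receives the code of a program, in \<open>xs ! 0\<close>.\<close>

lemma rec_fun_forbidden:
  assumes "computable_str A"
    and "\<And>n. \<exists>m. a * 2 ^ m \<le> b * card {u. length u = m \<and> n * 2 ^ n + n < length (A u)}"
  shows "rec_fun 3 (\<lambda>xs. enc (forbidden A a b (xs ! 1) (xs ! 2)))"
proof -
  have "rec_fun 1 (\<lambda>xs. LEAST s. xs ! 0 * card (evading A (xs ! 0) (stage A a b (xs ! 0)) (dec s))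
      \<le> 2 ^ stage A a b (xs ! 0))"
    unfolding evading_def
    by (intro rec_fun_Least exists_cover[unfolded evading_def] rec_fun_intros
        rec_fun_computable_str[OF assms(1)] rec_fun_stage[OF assms]) simp_all
  then have "rec_fun 1 (\<lambda>xs. enc (cover A a b (xs ! 0)))"
    unfolding cover_def by simp
  then have "rec_fun 3 (\<lambda>xs. enc (cover A a b (xs ! 2)))"
    by (rule rec_fun_comp1) (simp add: rec_fun_nth)
  then show ?thesis
    unfolding forbidden_def by (intro rec_fun_intros) simp_all
qed

text \<open>A decompressor that answers every program with the forbidden string describes it by the
  empty program; optimality of \<open>D\<close> then costs a constant that is uniform in
  \<open>k\<close> and \<open>n\<close>.\<close>

lemma KC_forbidden_bounded:
  assumes "optimal_dec D" and "computable_str A"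
    and "\<And>n. \<exists>m. a * 2 ^ m \<le> b * card {u. length u = m \<and> n * 2 ^ n + n < length (A u)}"
  obtains c where "\<And>k n. KC D (forbidden A a b k n) (k, n) \<le> enat c"
proof -
  let ?D = "\<lambda>p :: bool list. \<lambda>(k, n). Some (forbidden A a b k n)"
  obtain r where r: "\<And>xs. length xs = 3 \<Longrightarrow> eval r xs (enc (forbidden A a b (xs ! 1) (xs ! 2)))"
    using rec_fun_forbidden[OF assms(2,3)] unfolding rec_fun_def by blast
  \<comment> \<open>The equivalence needs determinism: \<open>r\<close> must not evaluate to any
    other value.\<close>
  have "eval r [enc p, k, n] z \<longleftrightarrow> z = enc (forbidden A a b k n)" for p k n z
    using r[of "[enc p, k, n]"] eval_deterministic by auto
  then have "partial_computable_dec ?D"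
    unfolding partial_computable_dec_def by (intro exI[of _ r]) simp
  then obtain c where c: "\<And>p' y x. ?D p' y = Some x \<Longrightarrow> \<exists>p. D p y = Some x \<and> length p \<le> length p' + c"
    using assms(1) unfolding optimal_dec_def by blast
  have "KC D (forbidden A a b k n) (k, n) \<le> enat c" for k n
  proof -
    obtain p where "D p (k, n) = Some (forbidden A a b k n)" "length p \<le> c"
      using c[where p' = "[]" and y = "(k, n)" and x = "forbidden A a b k n"] by auto
    then show ?thesis unfolding KC_def by (intro INF_lower2[of p]) auto
  qed
  then show ?thesis by (rule that)
qed

section \<open>Probability of avoiding the forbidden strings\<close>

lemma prob_space_coin: "prob_space coin"
  unfolding coin_def by (intro prob_space_PiM prob_space_measure_pmf)

lemma space_coin: "space coin = UNIV"
  unfolding coin_def by (simp add: space_PiM PiE_UNIV_domain)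

lemma length_rprefix [simp]: "length (rprefix r m) = m"
  unfolding rprefix_def by simp

lemma prefix_rprefix: "m \<le> m' \<Longrightarrow> prefix (rprefix r m) (rprefix r m')"
  unfolding rprefix_def using upt_add_eq_append[of 0 m "m' - m"] by (intro map_mono_prefix) simp

text \<open>A cylinder is a box in the product space with finitely many singleton sides, each of
  probability 1/2.\<close>

lemma coin_cylinder:
  shows sets_coin_cylinder: "{r. rprefix r (length u) = u} \<in> sets coin"
    and measure_coin_cylinder: "measure coin {r. rprefix r (length u) = u} = 1 / 2 ^ length u"
proof -
  let ?M = "\<lambda>_ :: nat. measure_pmf (bernoulli_pmf (1 / 2))"
  have eq: "{r. rprefix r (length u) = u} =
      prod_emb UNIV ?M {..<length u} (PiE {..<length u} (\<lambda>i. {u ! i}))"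
  proof (rule set_eqI)
    fix r
    have "rprefix r (length u) = u \<longleftrightarrow> (\<forall>i<length u. r i = u ! i)"
      unfolding list_eq_iff_nth_eq by (simp add: rprefix_def)
    also have "\<dots> \<longleftrightarrow> r \<in> prod_emb UNIV ?M {..<length u} (PiE {..<length u} (\<lambda>i. {u ! i}))"
      by (auto simp: prod_emb_iff PiE_iff)
    finally show "r \<in> {r. rprefix r (length u) = u} \<longleftrightarrow>
        r \<in> prod_emb UNIV ?M {..<length u} (PiE {..<length u} (\<lambda>i. {u ! i}))"
      by simp
  qed
  show "{r. rprefix r (length u) = u} \<in> sets coin"
    unfolding eq coin_def by (rule sets_PiM_I) auto
  have "emeasure coin {r. rprefix r (length u) = u} = (\<Prod>i<length u. emeasure (?M i) {u ! i})"
    unfolding eq coin_def by (rule emeasure_PiM_emb) (auto intro: prob_space_measure_pmf)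
  also have "\<dots> = (\<Prod>i<length u. ennreal (1 / 2))"
  proof -
    have "emeasure (measure_pmf (bernoulli_pmf (1 / 2))) {b} = ennreal (1 / 2)" for b
      by (cases b) (simp_all add: emeasure_pmf_single)
    then show ?thesis by simp
  qed
  also have "\<dots> = ennreal (1 / 2 ^ length u)"
    by (simp only: prod_constant ennreal_power power_one_over card_lessThan)
  finally show "measure coin {r. rprefix r (length u) = u} = 1 / 2 ^ length u"
    by (simp add: measure_def)
qed

lemma rprefix_mem_eq:
  assumes "U \<subseteq> {u. length u = m}"
  shows "{r. rprefix r m \<in> U} = (\<Union>u\<in>U. {r. rprefix r (length u) = u})"
  using assms by auto

text \<open>An event that depends on the first \<open>m\<close> bits is a finite union of cylinders.
  As \<open>P\<close> is arbitrary, this covers conditions on \<open>KC\<close>.\<close>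

lemma sets_coin_rprefix: "{r. P (rprefix r m)} \<in> sets coin"
proof -
  have "{r. P (rprefix r m)} = {r. rprefix r m \<in> {u. length u = m \<and> P u}}" by simp
  also have "\<dots> = (\<Union>u\<in>{u. length u = m \<and> P u}. {r. rprefix r (length u) = u})"
    by (rule rprefix_mem_eq) auto
  also have "\<dots> \<in> sets coin"
    by (intro sets.finite_UN sets_coin_cylinder) (rule finite_subset[OF _ finite_strings[of m]], auto)
  finally show ?thesis .
qed

lemma measure_coin_rprefix:
  assumes U: "U \<subseteq> {u. length u = m}"
  shows "measure coin {r. rprefix r m \<in> U} = card U / 2 ^ m"
proof -
  interpret prob_space coin by (rule prob_space_coin)
  have fin: "finite U" using finite_subset[OF U finite_strings] .
  have "measure coin {r. rprefix r m \<in> U} = (\<Sum>u\<in>U. measure coin {r. rprefix r (length u) = u})"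
    unfolding rprefix_mem_eq[OF U]
  proof (rule finite_measure_finite_Union[OF fin])
    have "length u = m" if "u \<in> U" for u using U that by auto
    then show "disjoint_family_on (\<lambda>u. {r. rprefix r (length u) = u}) U"
      unfolding disjoint_family_on_def by auto
  qed (auto simp: sets_coin_cylinder)
  also have "\<dots> = (\<Sum>u\<in>U. 1 / 2 ^ m)"
    using U by (intro sum.cong) (auto simp: measure_coin_cylinder)
  finally show ?thesis by simp
qed

definition reached :: "(bool list \<Rightarrow> bool list) \<Rightarrow> nat \<Rightarrow> (nat \<Rightarrow> bool) set" where
  "reached A l = {r. \<exists>m. l < length (A (rprefix r m))}"

lemma sets_coin_reached: "reached A l \<in> sets coin"
proof -
  have "reached A l = (\<Union>m. {r. l < length (A (rprefix r m))})" unfolding reached_def by auto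
  also have "\<dots> \<in> sets coin" by (intro sets.countable_UN) (auto intro: sets_coin_rprefix[where P = "\<lambda>u. l < length (A u)"])
  finally show ?thesis .
qed

text \<open>By prefix monotonicity the events \<open>?R m\<close> increase to
  \<open>reached A l\<close>, so continuity from below lets their probability exceed
  \<open>a / b\<close> at some finite depth.\<close>

lemma exists_stage:
  assumes mono: "\<And>u v. prefix u v \<Longrightarrow> prefix (A u) (A v)"
    and less: "real a / real b < measure coin (reached A l)" and "b > 0"
  shows "\<exists>m. a * 2 ^ m \<le> b * card {u. length u = m \<and> l < length (A u)}"
proof -
  interpret prob_space coin by (rule prob_space_coin)
  let ?R = "\<lambda>m. {r. l < length (A (rprefix r m))}"
  have "incseq ?R"
  proof (rule incseq_SucI, clarify)
    fix m r assume "l < length (A (rprefix r m))"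
    then show "l < length (A (rprefix r (Suc m)))"
      using prefix_length_le[OF mono[OF prefix_rprefix[of m "Suc m" r]]] by simp
  qed
  then have "(\<lambda>m. measure coin (?R m)) \<longlonglongrightarrow> measure coin (\<Union>m. ?R m)"
    by (intro finite_Lim_measure_incseq) (auto intro: sets_coin_rprefix[where P = "\<lambda>u. l < length (A u)"])
  moreover have "(\<Union>m. ?R m) = reached A l" unfolding reached_def by auto
  ultimately have "eventually (\<lambda>m. real a / real b < measure coin (?R m)) sequentially"
    using less by (auto intro: order_tendstoD)
  then obtain m where m: "real a / real b < measure coin (?R m)"
    by (auto simp: eventually_sequentially)
  have "?R m = {r. rprefix r m \<in> {u. length u = m \<and> l < length (A u)}}" by simp
  then have "measure coin (?R m) = card {u. length u = m \<and> l < length (A u)} / 2 ^ m"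
    by (simp only:) (rule measure_coin_rprefix, auto)
  with m have "real a / b < card {u. length u = m \<and> l < length (A u)} / 2 ^ m" by (simp only:)
  then have "real (a * 2 ^ m) < real (b * card {u. length u = m \<and> l < length (A u)})"
    using \<open>b > 0\<close> by (simp add: field_simps)
  then show ?thesis by (intro exI[of _ m]) (simp only: of_nat_less_iff less_imp_le)
qed

lemma measure_avoiding_le:
  assumes stage: "\<exists>m. a * 2 ^ m \<le> b * card {u. length u = m \<and> n * 2 ^ n + n < length (A u)}"
    and "n > 0" "b > 0" and G: "G \<subseteq> reached A (n * 2 ^ n + n)"
    and avoid: "\<And>r k m. r \<in> G \<Longrightarrow> n * 2 ^ n + n < length (A (rprefix r m)) \<Longrightarrow> k < n * 2 ^ n \<Longrightarrow>
      take n (drop k (A (rprefix r m))) \<noteq> forbidden A a b k n"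
  shows "measure coin G \<le> measure coin (reached A (n * 2 ^ n + n)) - a / b + 1 / n"
proof -
  interpret prob_space coin by (rule prob_space_coin)
  let ?m = "stage A a b n" and ?R = "reached A (n * 2 ^ n + n)"
  let ?U = "{u. length u = ?m \<and> n * 2 ^ n + n < length (A u)}"
  let ?V = "evading A n ?m (cover A a b n)"
  have U: "?U \<subseteq> {u. length u = ?m}" and V: "?V \<subseteq> {u. length u = ?m}"
    unfolding evading_def by auto
  have "a * 2 ^ ?m \<le> b * card ?U"
    unfolding stage_def by (rule LeastI_ex[OF stage])
  then have "real (a * 2 ^ ?m) \<le> real (b * card ?U)" by (simp only: of_nat_le_iff)
  then have "a / b \<le> measure coin {r. rprefix r ?m \<in> ?U}"
    using \<open>b > 0\<close> unfolding measure_coin_rprefix[OF U] by (simp add: field_simps)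
  moreover have "measure coin {r. rprefix r ?m \<in> ?V} \<le> 1 / n"
  proof -
    have "real (n * card ?V) \<le> real (2 ^ ?m)"
      using card_evading_cover[of n A a b] by (simp only: of_nat_le_iff)
    then show ?thesis
      using \<open>n > 0\<close> unfolding measure_coin_rprefix[OF V] by (simp add: field_simps)
  qed
  moreover have "measure coin G \<le> measure coin (?R - {r. rprefix r ?m \<in> ?U}) + measure coin {r. rprefix r ?m \<in> ?V}"
  proof -
    \<comment> \<open>At depth \<open>?m\<close> either the output is still too short, which has
      probability at most that of \<open>?R\<close> minus \<open>a / b\<close>, or it is long enough
      and evades every forbidden string.\<close>
    have "r \<in> (?R - {r. rprefix r ?m \<in> ?U}) \<union> {r. rprefix r ?m \<in> ?V}" if "r \<in> G" for r
      using that G avoid[OF that, of ?m] unfolding evading_def forbidden_def by auto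
    then have "measure coin G \<le> measure coin ((?R - {r. rprefix r ?m \<in> ?U}) \<union> {r. rprefix r ?m \<in> ?V})"
      by (intro finite_measure_mono sets.Un sets.Diff sets_coin_reached sets_coin_rprefix) auto
    also have "\<dots> \<le> measure coin (?R - {r. rprefix r ?m \<in> ?U}) + measure coin {r. rprefix r ?m \<in> ?V}"
      by (intro measure_Un_le sets.Diff sets_coin_reached sets_coin_rprefix)
    finally show ?thesis .
  qed
  moreover have "measure coin (?R - {r. rprefix r ?m \<in> ?U}) = measure coin ?R - measure coin {r. rprefix r ?m \<in> ?U}"
    by (rule finite_measure_Diff[OF sets_coin_reached sets_coin_rprefix]) (auto simp: reached_def)
  ultimately show ?thesis by linarith
qed

section \<open>Random sequences whose output satisfies the complexity bound\<close>

text \<open>The required property stated through finite outputs only, without the limit sequence;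
  this exhibits it as a countable combination of events on finitely many bits.\<close>

definition complex_output ::
  "(bool list \<Rightarrow> nat \<times> nat \<Rightarrow> bool list option) \<Rightarrow> (bool list \<Rightarrow> bool list) \<Rightarrow> (nat \<Rightarrow> nat) \<Rightarrow> (nat \<Rightarrow> bool) set"
where
  "complex_output D A g = {r. (\<forall>i. r \<in> reached A i) \<and>
    (\<forall>k n m. k + n < length (A (rprefix r m)) \<longrightarrow>
      enat (g n) \<le> KC D (take n (drop k (A (rprefix r m)))) (k, n))}"

lemma outputs_inf_iff:
  assumes mono: "\<And>u v. prefix u v \<Longrightarrow> prefix (A u) (A v)"
  shows "(\<exists>w. outputs_inf A r w \<and> (\<forall>k n. enat (g n) \<le> KC D (segment w k (k + n)) (k, n)))
    \<longleftrightarrow> r \<in> complex_output D A g"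
proof -
  have segment: "segment w k (k + n) = take n (drop k (A (rprefix r m)))"
    if "outputs_inf A r w" "k + n < length (A (rprefix r m))" for w k n m
    using that unfolding outputs_inf_def segment_def by (intro nth_equalityI) auto
  show ?thesis
  proof safe
    fix w assume w: "outputs_inf A r w" "\<forall>k n. enat (g n) \<le> KC D (segment w k (k + n)) (k, n)"
    show "r \<in> complex_output D A g"
      unfolding complex_output_def reached_def mem_Collect_eq
    proof (intro conjI allI impI)
      show "\<exists>m. i < length (A (rprefix r m))" for i
        using w(1) unfolding outputs_inf_def by blast
      show "enat (g n) \<le> KC D (take n (drop k (A (rprefix r m)))) (k, n)"
        if "k + n < length (A (rprefix r m))" for k n m
        using w(2)[rule_format, of n k] segment[OF w(1) that] by simp
    qed
  next
    assume r: "r \<in> complex_output D A g"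
    then obtain M where M: "\<And>i. i < length (A (rprefix r (M i)))"
      unfolding complex_output_def reached_def mem_Collect_eq by metis
    define w where "w i = A (rprefix r (M i)) ! i" for i
    have "A (rprefix r m) ! i = w i" if "i < length (A (rprefix r m))" for i m
    \<comment> \<open>Whichever of the depths \<open>m\<close> and \<open>M i\<close> is smaller,
      its output is a prefix of the other one, so both agree at \<open>i\<close>.\<close>
    proof (cases "m \<le> M i")
      case True
      then show ?thesis
        using that mono[OF prefix_rprefix[OF True, of r]] unfolding w_def by (auto simp: prefix_def nth_append)
    next
      case False
      then have "M i \<le> m" by simp
      then show ?thesis
        using M[of i] mono[OF prefix_rprefix[OF \<open>M i \<le> m\<close>, of r]] unfolding w_def
        by (auto simp: prefix_def nth_append)
    qed
    then have w: "outputs_inf A r w" unfolding outputs_inf_def using M by blast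
    moreover have "enat (g n) \<le> KC D (segment w k (k + n)) (k, n)" for k n
      using r M[of "k + n"] segment[OF w M[of "k + n"]] unfolding complex_output_def by simp
    ultimately show "\<exists>w. outputs_inf A r w \<and> (\<forall>k n. enat (g n) \<le> KC D (segment w k (k + n)) (k, n))"
      by blast
  qed
qed

lemma sets_coin_complex_output: "complex_output D A g \<in> sets coin"
proof -
  have "complex_output D A g = (\<Inter>i. reached A i) \<inter>
    (\<Inter>k. \<Inter>n. \<Inter>m. {r. k + n < length (A (rprefix r m)) \<longrightarrow>
      enat (g n) \<le> KC D (take n (drop k (A (rprefix r m)))) (k, n)})"
    unfolding complex_output_def by auto
  also have "\<dots> \<in> sets coin"
    by (intro sets.Int sets.countable_INT'' sets_coin_reached sets_coin_rprefix) (auto simp flip: space_coin)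
  finally show ?thesis .
qed

lemma exists_fraction_below:
  fixes x e :: real
  assumes "x > 0" "e > 0"
  obtains a b :: nat where "b > 0" "real a / real b < x" "x - e < real a / real b"
proof -
  obtain b :: nat where b: "b > 0" "1 / real b < e"
    using reals_Archimedean[OF \<open>e > 0\<close>] that[of "Suc n" for n] by (auto simp: inverse_eq_divide)
  \<comment> \<open>The largest integer strictly below \<open>x * b\<close>, hence
    \<open>a / b\<close> falls short of \<open>x\<close> by at most \<open>1 / b\<close>; positivity
    of \<open>x\<close> keeps it in the natural numbers.\<close>
  define a where "a = nat (\<lceil>x * b\<rceil> - 1)"
  have "\<lceil>x * b\<rceil> \<ge> 1" using b(1) \<open>x > 0\<close> by simp
  then have "real a = of_int \<lceil>x * b\<rceil> - 1" unfolding a_def by simp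
  then have "real a < x * b" "x * b \<le> real a + 1" by linarith+
  then have "real a / b < x" "x \<le> real a / b + 1 / b"
    using b(1) by (auto simp: field_simps)
  then show ?thesis using b by (intro that[of b a]) auto
qed

text \<open>A positive probability of \<open>?G\<close> leaves room for a fraction
  \<open>a / b\<close> with \<open>?\<Omega> - a / b < measure coin ?G\<close>, contrary to the
  bound obtained in the limit of large \<open>n\<close>.\<close>

lemma complex_output_null:
  assumes D: "optimal_dec D" and A: "prob_algorithm A"
    and mono: "mono g" and unbounded: "\<And>m. \<exists>n. m \<le> g n"
  shows "complex_output D A g \<in> null_sets coin"
proof (rule ccontr)
  interpret prob_space coin by (rule prob_space_coin)
  let ?G = "complex_output D A g" and ?\<Omega> = "measure coin (\<Inter>i. reached A i)"
  have prefix: "\<And>u v. prefix u v \<Longrightarrow> prefix (A u) (A v)" and comp: "computable_str A"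
    using A unfolding prob_algorithm_def by auto
  assume "?G \<notin> null_sets coin"
  then have pos: "measure coin ?G > 0"
    using sets_coin_complex_output[of D A g]
    by (auto simp: null_sets_def emeasure_eq_measure zero_less_measure_iff)
  have inf: "(\<Inter>i. reached A i) \<in> sets coin"
    by (intro sets.countable_INT'' sets_coin_reached) (auto simp flip: space_coin)
  have "measure coin ?G \<le> ?\<Omega>"
    by (rule finite_measure_mono[OF _ inf]) (auto simp: complex_output_def)
  with pos have "?\<Omega> > 0" by linarith
  then obtain a b :: nat where b: "b > 0" and ab: "real a / real b < ?\<Omega>" "?\<Omega> - measure coin ?G < real a / real b"
    using pos by (rule exists_fraction_below)
  \<comment> \<open>Since \<open>a / b < ?\<Omega>\<close> lies below the probability of every
    \<open>reached A l\<close>, a single fraction makes the search halt for all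
    \<open>n\<close>.\<close>
  have stage: "\<exists>m. a * 2 ^ m \<le> b * card {u. length u = m \<and> l < length (A u)}" for l
  proof (rule exists_stage[OF prefix _ b])
    have "?\<Omega> \<le> measure coin (reached A l)"
      by (rule finite_measure_mono) (auto simp: sets_coin_reached)
    with ab show "real a / real b < measure coin (reached A l)" by simp
  qed
  obtain c where c: "\<And>k n. KC D (forbidden A a b k n) (k, n) \<le> enat c"
    using KC_forbidden_bounded[OF D comp stage] by blast
  obtain n0 where n0: "Suc c \<le> g n0" using unbounded by blast
  \<comment> \<open>From \<open>n0\<close> on monotonicity keeps \<open>g n\<close> above
    \<open>c\<close>; starting at \<open>Suc n0\<close> also makes \<open>n\<close>
    positive.\<close>
  have bound: "measure coin ?G \<le> measure coin (reached A (n * 2 ^ n + n)) - a / b + 1 / n"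
    if "n \<ge> Suc n0" for n
  proof (rule measure_avoiding_le[OF stage _ b])
    fix r k m
    assume r: "r \<in> ?G" "n * 2 ^ n + n < length (A (rprefix r m))" "k < n * 2 ^ n"
    then have "enat (g n) \<le> KC D (take n (drop k (A (rprefix r m)))) (k, n)"
      unfolding complex_output_def by simp
    moreover have "c < g n" using n0 monoD[OF mono, of n0 n] that by simp
    ultimately show "take n (drop k (A (rprefix r m))) \<noteq> forbidden A a b k n"
      using c[of k n] by (auto dest: order.trans)
  qed (use that in \<open>auto simp: complex_output_def\<close>)
  \<comment> \<open>Continuity from above: the events \<open>reached A l\<close> decrease to
    infinite output.\<close>
  have "decseq (reached A)"
    unfolding decseq_def reached_def by (auto dest: le_less_trans)
  then have "(\<lambda>l. measure coin (reached A l)) \<longlonglongrightarrow> ?\<Omega>"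
    by (intro finite_Lim_measure_decseq) (auto simp: sets_coin_reached)
  moreover have "filterlim (\<lambda>n :: nat. n * 2 ^ n + n) at_top sequentially"
    by (rule filterlim_at_top_mono[OF filterlim_ident]) simp
  ultimately have "(\<lambda>n :: nat. measure coin (reached A (n * 2 ^ n + n))) \<longlonglongrightarrow> ?\<Omega>"
    by (rule filterlim_compose)
  then have "(\<lambda>n :: nat. measure coin (reached A (n * 2 ^ n + n)) - a / b + 1 / n) \<longlonglongrightarrow> ?\<Omega> - a / b + 0"
    by (intro tendsto_intros lim_1_over_n)
  then have "measure coin ?G \<le> ?\<Omega> - a / b + 0"
    by (rule LIMSEQ_le_const) (use bound in blast)
  with ab show False by simp
qed

theorem theorem3:
  fixes D :: "bool list \<Rightarrow> nat \<times> nat \<Rightarrow> bool list option"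
    and A :: "bool list \<Rightarrow> bool list"
  assumes "optimal_dec D"
    and "prob_algorithm A"
  shows "{r. \<exists>w. outputs_inf A r w \<and>
            (\<exists>g. mono g \<and> (\<forall>m. \<exists>n. m \<le> g n) \<and> computable_nat g \<and>
                 (\<forall>k n. KC D (segment w k (k + n)) (k, n) \<ge> enat (g n)))}
         \<in> null_sets coin"
proof -
  let ?C = "{g. mono g \<and> (\<forall>m. \<exists>n. m \<le> g n) \<and> computable_nat g}"
  have prefix: "\<And>u v. prefix u v \<Longrightarrow> prefix (A u) (A v)"
    using assms(2) unfolding prob_algorithm_def by auto
  have "countable ?C"
    by (rule countable_subset[OF _ countable_computable_nat]) auto
  then have "(\<Union>g\<in>?C. complex_output D A g) \<in> null_sets coin"
    by (rule null_sets_UN') (use complex_output_null[OF assms] in blast)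
  \<comment> \<open>Exchanging the quantifiers over \<open>w\<close> and \<open>g\<close> turns the
    event into a countable union, which also settles its measurability.\<close>
  moreover have "{r. \<exists>w. outputs_inf A r w \<and>
      (\<exists>g. mono g \<and> (\<forall>m. \<exists>n. m \<le> g n) \<and> computable_nat g \<and>
        (\<forall>k n. KC D (segment w k (k + n)) (k, n) \<ge> enat (g n)))} = (\<Union>g\<in>?C. complex_output D A g)"
    using outputs_inf_iff[where A = A and D = D, OF prefix] by blast
  ultimately show ?thesis by simp
qed

end
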